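(* Let $m\ge 1$ be an integer, let $x_1,\dots,x_m$ be elements of a commutative ring, and let $B_m(x_1,\dots,x_m)$ be the $m\times m$ matrix whose $(p,q)$ entry is $x_{\max(p,q)}$ for $1\le p,q\le m$. Then $$\det B_m(x_1,\dots,x_m)=\prod_{i=1}^{m}(x_i-x_{i+1}),\qquad\text{where } x_{m+1}=0.$$
   Context: The matrix is, explicitly, $$B_m(x_1,\dots,x_m)=\begin{pmatrix} x_1 & x_2 & \cdots & x_{m-1} & x_m\\ x_2 & x_2 & \cdots & x_{m-1} & x_m\\ \vdots&\vdots&\ddots&\vdots&\vdots\\ x_{m-1} & x_{m-1} & \cdots & x_{m-1} & x_m\\ x_m & x_m&\cdots & x_m & x_m\end{pmatrix}.$$ *)

theory Defs
  imports "Jordan_Normal_Form.Determinant"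
begin

(* Matrices are indexed from 0 while x is indexed from 1 (only x 1, ..., x m are used),
   so the entry at (p, q) is x (max (p + 1) (q + 1)). *)
definition B_mat :: "nat \<Rightarrow> (nat \<Rightarrow> 'a) \<Rightarrow> 'a mat" where
  "B_mat m x = mat m m (\<lambda>(p, q). x (max (Suc p) (Suc q)))"

end

theory Submission
  imports Defs
begin

text \<open>
  Put \<open>y i = x i - x (i + 1)\<close> with \<open>x (m + 1) = 0\<close>. Telescoping gives
  \<open>x (max p q) = (\<Sum>k = 1..m. [p \<le> k] * y k * [q \<le> k])\<close>, so the matrix is the product of an
  upper triangular matrix with diagonal \<open>y\<close> and a lower unitriangular matrix.
\<close>

lemma det_mat_upper_triangular:
  fixes f :: "nat \<Rightarrow> nat \<Rightarrow> 'a :: comm_ring_1"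
  assumes "\<And>i j. j < i \<Longrightarrow> i < n \<Longrightarrow> f i j = 0"
  shows "det (mat n n (\<lambda>(i, j). f i j)) = (\<Prod>i<n. f i i)"
proof -
  have "det (mat n n (\<lambda>(i, j). f i j)) = prod_list (diag_mat (mat n n (\<lambda>(i, j). f i j)))"
    using assms by (intro det_upper_triangular[of _ n]) auto
  then show ?thesis
    by (simp add: prod_list_diag_prod atLeast0LessThan)
qed

lemma det_mat_lower_triangular:
  fixes f :: "nat \<Rightarrow> nat \<Rightarrow> 'a :: comm_ring_1"
  assumes "\<And>i j. i < j \<Longrightarrow> j < n \<Longrightarrow> f i j = 0"
  shows "det (mat n n (\<lambda>(i, j). f i j)) = (\<Prod>i<n. f i i)"
proof -
  have "det (mat n n (\<lambda>(i, j). f i j)) = prod_list (diag_mat (mat n n (\<lambda>(i, j). f i j)))"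
    using assms by (intro det_lower_triangular[of n]) auto
  then show ?thesis
    by (simp add: prod_list_diag_prod atLeast0LessThan)
qed

text \<open>The two indicators leave only the indices \<open>k\<close> with
  \<open>max p q \<le> k\<close>, and the remaining sum telescopes. The left side is the entry at
  \<open>(p, q)\<close> of the triangular product \<open>U * L\<close> formed in the
  theorem.\<close>

lemma sum_diff_above_max:
  fixes z :: "nat \<Rightarrow> 'a :: comm_ring_1"
  assumes "p < m" "q < m"
  shows "(\<Sum>k = 0..<m. (if p \<le> k then z k - z (Suc k) else 0) * (if q \<le> k then 1 else 0))
    = z (max p q) - z m"
proof -
  have "(\<Sum>k = 0..<m. (if p \<le> k then z k - z (Suc k) else 0) * (if q \<le> k then 1 else 0))
      = (\<Sum>k = max p q..<m. z k - z (Suc k))"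
    by (rule sum.mono_neutral_cong_right) auto
  \<comment> \<open>The sign is flipped because \<open>sum_Suc_diff'\<close> telescopes differences
    of the form \<open>z (Suc k) - z k\<close>.\<close>
  also have "\<dots> = - (\<Sum>k = max p q..<m. z (Suc k) - z k)"
    by (simp flip: sum_negf)
  also have "\<dots> = z (max p q) - z m"
    using assms by (simp add: sum_Suc_diff')
  finally show ?thesis .
qed

theorem proposition1p2:
  fixes x :: "nat \<Rightarrow> 'a :: comm_ring_1" and m :: nat
  assumes "m \<ge> 1"
  shows "det (B_mat m x) = (\<Prod>i = 1..m. x i - (if i + 1 = m + 1 then 0 else x (i + 1)))"
proof -
  \<comment> \<open>Shift of \<open>x\<close> to indices from 0; the value \<open>z m = 0\<close>
    encodes the convention that \<open>x (m + 1)\<close> counts as 0.\<close>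
  define z where "z k = (if k = m then 0 else x (Suc k))" for k
  define U where "U = mat m m (\<lambda>(p, k). if p \<le> k then z k - z (Suc k) else 0)"
  define L where "L = mat m m (\<lambda>(k, q). if q \<le> k then 1 else 0 :: 'a)"
  have "B_mat m x = U * L"
  proof (rule eq_matI)
    fix p q assume "p < dim_row (U * L)" "q < dim_col (U * L)"
    then have pq: "p < m" "q < m" by (simp_all add: U_def L_def)
    then have "(U * L) $$ (p, q)
        = (\<Sum>k = 0..<m. (if p \<le> k then z k - z (Suc k) else 0) * (if q \<le> k then 1 else 0))"
      by (simp add: U_def L_def scalar_prod_def)
    also have "\<dots> = z (max p q) - z m"
      using pq by (rule sum_diff_above_max)
    \<comment> \<open>Here \<open>z m = 0\<close>, while \<open>max p q < m\<close> keeps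
      \<open>z (max p q)\<close> out of the exceptional case.\<close>
    also have "\<dots> = B_mat m x $$ (p, q)"
      using pq by (auto simp: z_def B_mat_def max_def)
    finally show "B_mat m x $$ (p, q) = (U * L) $$ (p, q)" by simp
  qed (simp_all add: B_mat_def U_def L_def)
  then have "det (B_mat m x) = det U * det L"
    by (simp add: U_def L_def det_mult[of _ m])
  also have "det U = (\<Prod>k<m. z k - z (Suc k))"
    unfolding U_def by (subst det_mat_upper_triangular) auto
  also have "det L = 1"
    unfolding L_def by (subst det_mat_lower_triangular) auto
  \<comment> \<open>Reindexing by \<open>i = Suc k\<close>: the last factor,
    \<open>k = m - 1\<close>, is the one where \<open>z (Suc k)\<close> vanishes.\<close>
  also have "(\<Prod>k<m. z k - z (Suc k)) * 1
      = (\<Prod>i = 1..m. x i - (if i + 1 = m + 1 then 0 else x (i + 1)))"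
    by (simp add: prod.atLeast1_atMost_eq z_def cong: if_cong)
  finally show ?thesis .
qed

end
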